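(* For every tree $T$ (all of whose edges are regarded as red) there exists $\beta_T\in(0,1)$ such that for every $\beta\in(\beta_T,1]$, the graph sequence $(G_n)$ with $G_n=K((1+o(1))\sqrt{\beta}\,n,\,n)$ achieves $I(T,\beta)$, i.e. $\rho(T,(G_n))=I(T,\beta)$.
   Context: A red/blue graph $H$ is a graph each of whose edges is colored red or blue (other pairs of vertices are unspecified). A red/blue clique $G$ is a complete graph each of whose edges is colored red or blue. For a red/blue graph $H$ with $h$ vertices and a red/blue clique $G$, $(\#H,G)$ denotes the number of injections $f:V(H)\to V(G)$ such that for every $uv\in E(H)$, the edge $f(u)f(v)$ of $G$ has the same color as $uv$. A sequence $(G_n)_{n\ge 1}$ of red/blue cliques has density $\beta$ if $|V(G_n)|=n$ and the proportion of edges of $G_n$ that are red tends to $\beta$. The sequence is $H$-good if $\rho(H,(G_n)):=\lim_{n\to\infty}(\#H,G_n)/n^h$ exists. $I(H,\beta)$ is the supremum of $\rho(H,(G_n))$ over all $H$-good sequences $(G_n)$ with density $\beta$. An ordinary graph is identified with the red/blue clique on the same vertex set in which its edges are red and its non-edges are blue. For an integer $0\le a\le n$, $K(a,n)$ is the $n$-vertex graph consisting of a clique on $a$ vertices and $n-a$ isolated vertices. Here $K((1+o(1))\sqrt{\beta}\,n,n)$ means $K(a_n,n)$ for integers $0\le a_n\le n$ with $a_n/n\to\sqrt{\beta}$. *)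

theory Defs
  imports "HOL-Analysis.Analysis" "HOL-Library.Ramsey"
begin

text \<open>
  Undirected edges are two-element vertex sets, and \<open>[V]\<^bsup>2\<^esup>\<close>
  (\<^const>\<open>nsets\<close>) is the set of all two-element subsets of \<open>V\<close>.
\<close>

record 'a ugraph =
  uverts :: "'a set"
  uedges :: "'a set set"

definition simple_graph :: "'a ugraph \<Rightarrow> bool" where
  "simple_graph G \<longleftrightarrow> finite (uverts G) \<and> uedges G \<subseteq> [uverts G]\<^bsup>2\<^esup>"

definition connected_graph :: "'a ugraph \<Rightarrow> bool" where
  "connected_graph G \<longleftrightarrow> uverts G \<noteq> {} \<and>
     (\<forall>u\<in>uverts G. \<forall>v\<in>uverts G. (u, v) \<in> {(x, y). {x, y} \<in> uedges G}\<^sup>*)"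

text \<open>A cycle is given by the list of its vertices; the last is adjacent to the first.\<close>

definition is_cycle :: "'a ugraph \<Rightarrow> 'a list \<Rightarrow> bool" where
  "is_cycle G xs \<longleftrightarrow> 3 \<le> length xs \<and> distinct xs \<and>
     (\<forall>i<length xs. {xs ! i, xs ! (Suc i mod length xs)} \<in> uedges G)"

definition is_tree :: "'a ugraph \<Rightarrow> bool" where
  "is_tree T \<longleftrightarrow> simple_graph T \<and> connected_graph T \<and> (\<nexists>xs. is_cycle T xs)"

record 'a rb =
  verts :: "'a set"
  red :: "'a set set"
  blue :: "'a set set"

definition rb_graph :: "'a rb \<Rightarrow> bool" where
  "rb_graph H \<longleftrightarrow> finite (verts H) \<and> red H \<union> blue H \<subseteq> [verts H]\<^bsup>2\<^esup> \<and> red H \<inter> blue H = {}"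

definition rb_clique :: "'a rb \<Rightarrow> bool" where
  "rb_clique G \<longleftrightarrow> rb_graph G \<and> red G \<union> blue G = [verts G]\<^bsup>2\<^esup>"

text \<open>An ordinary graph as a red/blue graph: the non-edges are unspecified in
  \<open>all_red\<close> and blue in \<open>clique_of_graph\<close>.\<close>

definition all_red :: "'a ugraph \<Rightarrow> 'a rb" where
  "all_red T = \<lparr>verts = uverts T, red = uedges T, blue = {}\<rparr>"

definition clique_of_graph :: "'a ugraph \<Rightarrow> 'a rb" where
  "clique_of_graph G =
     \<lparr>verts = uverts G, red = uedges G, blue = [uverts G]\<^bsup>2\<^esup> - uedges G\<rparr>"

text \<open>
  The number \<open>(#H, G)\<close> of colour-preserving injections; functions are taken to be
  undefined off \<open>V(H)\<close>, so that each injection \<open>V(H) \<rightarrow> V(G)\<close> is counted once.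
\<close>

definition inj_count :: "'a rb \<Rightarrow> 'b rb \<Rightarrow> nat" where
  "inj_count H G = card {f \<in> verts H \<rightarrow>\<^sub>E verts G. inj_on f (verts H) \<and>
     (\<forall>e\<in>red H. f ` e \<in> red G) \<and> (\<forall>e\<in>blue H. f ` e \<in> blue G)}"

text \<open>
  A sequence \<open>(G\<^sub>n)\<close> is indexed by \<open>n \<ge> 1\<close>; its value at \<open>0\<close> is ignored.
\<close>

definition has_density :: "(nat \<Rightarrow> 'b rb) \<Rightarrow> real \<Rightarrow> bool" where
  "has_density G \<beta> \<longleftrightarrow> (\<forall>n\<ge>1. rb_clique (G n) \<and> card (verts (G n)) = n) \<and>
     (\<lambda>n. real (card (red (G n))) / real (card (red (G n) \<union> blue (G n)))) \<longlonglongrightarrow> \<beta>"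

definition good :: "'a rb \<Rightarrow> (nat \<Rightarrow> 'b rb) \<Rightarrow> bool" where
  "good H G \<longleftrightarrow> convergent (\<lambda>n. real (inj_count H (G n)) / real n ^ card (verts H))"

definition rho :: "'a rb \<Rightarrow> (nat \<Rightarrow> 'b rb) \<Rightarrow> real" where
  "rho H G = lim (\<lambda>n. real (inj_count H (G n)) / real n ^ card (verts H))"

text \<open>
  \<open>I(H, \<beta>)\<close>. Every finite clique has an isomorphic copy on a set of natural numbers, so
  nothing is lost by letting the supremum range over cliques with vertices in \<^typ>\<open>nat\<close>.
\<close>

definition I_sup :: "'a rb \<Rightarrow> real \<Rightarrow> real" where
  "I_sup H \<beta> = Sup {rho H G | G :: nat \<Rightarrow> nat rb. has_density G \<beta> \<and> good H G}"

definition K_graph :: "nat \<Rightarrow> nat \<Rightarrow> nat ugraph" where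
  "K_graph a n = \<lparr>uverts = {..<n}, uedges = [{..<a}]\<^bsup>2\<^esup>\<rparr>"

end

theory Submission
  imports Defs
begin

text \<open>
  Let \<open>T\<close> have \<open>h \<ge> 2\<close> vertices and let \<open>G\<close> be a graph on \<open>n\<close> vertices whose degrees
  \<open>d(x)\<close> sum to \<open>D\<close>, which is \<open>\<beta>n\<^sup>2\<close> up to lower order. Since \<open>T\<close> is connected, a copy
  of \<open>T\<close> in \<open>K(a,n)\<close> lies inside the clique, so that \<open>K(\<surd>\<beta> n, n)\<close> has density
  \<open>(\<surd>\<beta>)\<^sup>h\<close> of copies of \<open>T\<close>. What has to be shown is that no graph \<open>G\<close> has more,
  that is, at most \<open>(\<surd>D)\<^sup>h\<close> copies, provided that \<open>D\<close> is close to \<open>n\<^sup>2\<close>.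
  The value \<open>(\<surd>\<beta>)\<^sup>h\<close> is the same for all trees with \<open>h\<close> vertices, and this suggests
  to pass to the tree with the most copies, the star.

  \<^bold>\<open>Stars dominate.\<close> The number of homomorphisms \<open>T \<rightarrow> G\<close> is at most the number
  \<open>\<Sum>\<^sub>x d(x)\<^bsup>h-1\<^esup>\<close> of homomorphisms of the star with \<open>h - 1\<close> edges
  (\<open>sum_homs_le_sum_degree_power\<close>). Deleting a leaf \<open>w\<close> with neighbour \<open>u\<close> replaces the sum over
  the images of \<open>w\<close> by a factor \<open>d(f(u))\<close>. So one bounds, more generally, the sum of
  \<open>d(f(v))\<^sup>s\<close> over all homomorphisms \<open>f\<close>, for a marked vertex \<open>v\<close>: deleting a leaf other
  than \<open>v\<close> gives the weight \<open>d(f(u)) d(f(v))\<^sup>s\<close>, which the weighted inequality between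
  arithmetic and geometric mean turns into a convex combination of \<open>d(f(u))\<^bsup>s+1\<^esup>\<close> and
  \<open>d(f(v))\<^bsup>s+1\<^esup>\<close>, and induction applies to both.

  \<^bold>\<open>Stars in dense graphs.\<close> It remains to prove
  \<open>\<Sum>\<^sub>x d(x)\<^bsup>h-1\<^esup> \<le> (\<surd>D)\<^sup>h\<close> for \<open>D \<ge> (1 - h\<^bsup>-4\<^esup>) n\<^sup>2\<close> (\<open>sum_degree_power_le\<close>);
  for \<open>h = 2\<close> both sides are \<open>D\<close>, so let \<open>h \<ge> 3\<close>.
  Choose a set \<open>S\<close> of \<open>cn\<close> vertices which all have degree at least \<open>cn\<close> while all other
  vertices have degree at most \<open>cn\<close>; density forces \<open>c\<close> to be close to \<open>1\<close>. If \<open>G\<close> is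
  a clique on \<open>S\<close>, the inequality is asymptotically an equality, and the proof expands both
  sides around this case. Two quantities measure the deviation: the excess of the degrees in \<open>S\<close>
  over \<open>cn\<close>, and the degrees outside \<open>S\<close>. Double counting the edges between \<open>S\<close> and its
  complement bounds the first by the second, and this makes the first order terms
  harmless. In second order the sum of the squared excesses is dangerous. By counting the paths of
  length two with midpoint in \<open>S\<close> and both ends outside \<open>S\<close>, it exceeds the square of the
  excess sum essentially only by a term that is large when many outer vertices are joined to some
  but not all of \<open>S\<close> (\<open>bipartite_second_moment\<close>). Such vertices fall short
  of the chord of \<open>t \<mapsto> t\<^bsup>h-1\<^esup>\<close> on \<open>[0,c]\<close> by a first order amount (\<open>low_degree_power_le\<close>), which
  pays for that term; the square itself is paid for by the convexity of the right-hand side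
  (\<open>power_ge_quadratic_in_square\<close>).
\<close>

section \<open>Power inequalities\<close>

lemma power_diff_ge_tangent:
  fixes c w :: real
  assumes "0 \<le> c" "c \<le> w"
  shows "(real m + 1) * c ^ m * (w - c) \<le> w ^ (m + 1) - c ^ (m + 1)"
proof (induction m)
  case (Suc m)
  have "(real (Suc m) + 1) * c ^ Suc m * (w - c) = c * ((real m + 1) * c ^ m * (w - c)) + c ^ (m + 1) * (w - c)"
    by (simp add: algebra_simps)
  also have "\<dots> \<le> c * (w ^ (m + 1) - c ^ (m + 1)) + w ^ (m + 1) * (w - c)"
    using assms Suc.IH by (intro add_mono mult_left_mono mult_right_mono power_mono) auto
  also have "\<dots> = w ^ (Suc m + 1) - c ^ (Suc m + 1)" by (simp add: algebra_simps)
  finally show ?case .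
qed simp

lemma power_diff_le_tangent:
  fixes c w :: real
  assumes "0 \<le> c" "c \<le> w"
  shows "w ^ (m + 1) - c ^ (m + 1) \<le> (real m + 1) * w ^ m * (w - c)"
proof (induction m)
  case (Suc m)
  have "w ^ (Suc m + 1) - c ^ (Suc m + 1) = w * (w ^ (m + 1) - c ^ (m + 1)) + c ^ (m + 1) * (w - c)"
    by (simp add: algebra_simps)
  also have "\<dots> \<le> w * ((real m + 1) * w ^ m * (w - c)) + w ^ (m + 1) * (w - c)"
    using assms Suc.IH by (intro add_mono mult_left_mono mult_right_mono power_mono) auto
  also have "\<dots> = (real (Suc m) + 1) * w ^ Suc m * (w - c)"
    by (simp add: algebra_simps)
  finally show ?case .
qed simp

text \<open>
  The weighted inequality between arithmetic and geometric mean, in the form of the tangent to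
  \<open>t \<mapsto> t\<^bsup>s+1\<^esup>\<close> at \<open>x\<close>. It separates a
  product of weights at two vertices into weights at a single vertex.
\<close>

lemma weighted_power_le:
  fixes x y :: real
  assumes "0 \<le> x" "0 \<le> y"
  shows "(real s + 1) * (x ^ s * y) \<le> real s * x ^ (s + 1) + y ^ (s + 1)"
proof -
  have "(real s + 1) * x ^ s * (y - x) \<le> y ^ (s + 1) - x ^ (s + 1)"
  proof (cases "x \<le> y")
    case True
    then show ?thesis using power_diff_ge_tangent assms by simp
  next
    case False
    then show ?thesis using power_diff_le_tangent[of y x s] assms by (simp add: algebra_simps)
  qed
  then show ?thesis by (simp add: algebra_simps)
qed

section \<open>Stars maximise the number of homomorphisms\<close>

definition nbrs :: "('b \<Rightarrow> 'b \<Rightarrow> bool) \<Rightarrow> 'b set \<Rightarrow> 'b \<Rightarrow> 'b set" where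
  "nbrs adj A v = {u \<in> A. adj v u}"

lemma finite_nbrs [simp]: "finite A \<Longrightarrow> finite (nbrs adj A v)"
  by (simp add: nbrs_def)

lemma card_nbrs_le: "finite A \<Longrightarrow> card (nbrs adj A v) \<le> card A"
  by (auto simp: nbrs_def intro: card_mono)

text \<open>
  Connectedness by cuts, inside the vertex set \<open>W\<close>. In contrast to paths, cuts make it obvious that
  attaching a vertex preserves connectedness.
\<close>

definition cut_connected :: "'a set set \<Rightarrow> 'a set \<Rightarrow> bool" where
  "cut_connected E W \<longleftrightarrow>
    (\<forall>A. A \<subseteq> W \<and> A \<noteq> {} \<and> A \<noteq> W \<longrightarrow> (\<exists>u\<in>A. \<exists>w\<in>W - A. {u, w} \<in> E))"

lemma cut_connected_graph:
  assumes "simple_graph T" "connected_graph T"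
  shows "cut_connected (uedges T) (uverts T)"
  unfolding cut_connected_def
proof (intro allI impI, elim conjE)
  fix A assume A: "A \<subseteq> uverts T" "A \<noteq> {}" "A \<noteq> uverts T"
  then obtain a b where ab: "a \<in> A" "b \<in> uverts T - A" by blast
  with A assms have "(a, b) \<in> {(x, y). {x, y} \<in> uedges T}\<^sup>*"
    by (auto simp: connected_graph_def)
  then show "\<exists>u\<in>A. \<exists>w\<in>uverts T - A. {u, w} \<in> uedges T"
  proof (rule contrapos_pp)
    assume none: "\<not> (\<exists>u\<in>A. \<exists>w\<in>uverts T - A. {u, w} \<in> uedges T)"
    have "c \<in> A" if "(a, c) \<in> {(x, y). {x, y} \<in> uedges T}\<^sup>*" for c
      using that
    proof (induction rule: rtrancl_induct)
      case (step y z)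
      then have "{y, z} \<in> [uverts T]\<^bsup>2\<^esup>" using assms(1) unfolding simple_graph_def by blast
      then have "z \<in> uverts T" by simp
    with step none show ?case by blast
    qed (use ab in simp)
    with ab show "(a, b) \<notin> {(x, y). {x, y} \<in> uedges T}\<^sup>*" by blast
  qed
qed

lemma cut_connected_insert:
  assumes "cut_connected E X" "u \<in> X" "w \<notin> X" "{u, w} \<in> E"
  shows "cut_connected E (insert w X)"
  unfolding cut_connected_def
proof (intro allI impI, elim conjE)
  fix A assume A: "A \<subseteq> insert w X" "A \<noteq> {}" "A \<noteq> insert w X"
  show "\<exists>x\<in>A. \<exists>y\<in>insert w X - A. {x, y} \<in> E"
  proof (cases "A \<inter> X = {} \<or> X \<subseteq> A")
    case True
    then have "A = {w} \<or> A = X" using A by blast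
    then show ?thesis
      using assms by (auto simp: insert_commute)
  next
    case False
    then obtain x y where "x \<in> A \<inter> X" "y \<in> X - A \<inter> X" "{x, y} \<in> E"
      using assms(1)[unfolded cut_connected_def, rule_format, of "A \<inter> X"] by blast
    then show ?thesis by blast
  qed
qed

text \<open>
  Every connected graph with at least two vertices has a vertex other than \<open>v\<close> whose deletion leaves
  it connected: the vertex that is missing from a maximal connected proper subset containing \<open>v\<close>. In
  a tree this is a leaf.
\<close>

lemma removable_vertex:
  assumes "finite W" "cut_connected E W" "v \<in> W" "W \<noteq> {v}"
  obtains u w where "w \<in> W" "w \<noteq> v" "u \<in> W - {w}" "{u, w} \<in> E" "cut_connected E (W - {w})"
proof -
  define F where "F = {X. X \<subset> W \<and> v \<in> X \<and> cut_connected E X}"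
  have "{v} \<in> F" using assms by (auto simp: F_def cut_connected_def)
  moreover have "finite F"
    unfolding F_def by (rule finite_subset[of _ "Pow W"]) (use \<open>finite W\<close> in auto)
  ultimately obtain X where "X \<in> F" and max: "\<And>Y. Y \<in> F \<Longrightarrow> X \<subseteq> Y \<Longrightarrow> X = Y"
    using finite_has_maximal[of F] by (metis empty_iff)
  then have X: "X \<subset> W" "v \<in> X" "cut_connected E X" by (auto simp: F_def)
  obtain u w where uw: "u \<in> X" "w \<in> W - X" "{u, w} \<in> E"
    using assms(2)[unfolded cut_connected_def, rule_format, of X] X by blast
  then have "cut_connected E (insert w X)"
    using cut_connected_insert[OF X(3) uw(1) _ uw(3)] uw(2) by simp
  then have "insert w X \<in> F \<or> W = insert w X"
    using uw(2) X(1,2) by (auto simp: F_def)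
  then have "W = insert w X"
    using max[of "insert w X"] uw(2) by blast
  then have "W - {w} = X" using uw by blast
  then show thesis using that[of w u] X uw by auto
qed

definition homs :: "('b \<Rightarrow> 'b \<Rightarrow> bool) \<Rightarrow> 'b set \<Rightarrow> 'a set set \<Rightarrow> 'a set \<Rightarrow> ('a \<Rightarrow> 'b) set" where
  "homs adj V E W = {f \<in> W \<rightarrow>\<^sub>E V. \<forall>x\<in>W. \<forall>y\<in>W. {x, y} \<in> E \<longrightarrow> adj (f x) (f y)}"

lemma finite_homs: "finite V \<Longrightarrow> finite W \<Longrightarrow> finite (homs adj V E W)"
  unfolding homs_def by (rule finite_subset[of _ "W \<rightarrow>\<^sub>E V"]) (auto intro: finite_PiE)

text \<open>
  A homomorphism is determined by its restriction \<open>f\<close> to \<open>W - {w}\<close> and by the image of \<open>w\<close>,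
  which is one of the neighbours of \<open>f u\<close>. The second condition on \<open>h\<close> says that \<open>h\<close>
  ignores the image of \<open>w\<close>.
\<close>

lemma sum_homs_remove_vertex:
  fixes h :: "('a \<Rightarrow> 'b) \<Rightarrow> real"
  assumes "finite V" "finite W" and w: "w \<in> W" "u \<in> W - {w}" "{u, w} \<in> E"
    and h: "\<And>f. 0 \<le> h f" "\<And>f y. h (f(w := y)) = h f"
  shows "(\<Sum>f\<in>homs adj V E W. h f)
    \<le> (\<Sum>f\<in>homs adj V E (W - {w}). real (card (nbrs adj V (f u))) * h f)"
proof -
  let ?H = "homs adj V E (W - {w})"
  have "(\<Sum>f\<in>homs adj V E W. h f) \<le> (\<Sum>p\<in>Sigma ?H (\<lambda>f. nbrs adj V (f u)). h (fst p))"
  proof (rule sum_le_included[where i = "\<lambda>p. (fst p)(w := snd p)"])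
    show "\<forall>f\<in>homs adj V E W. \<exists>p\<in>Sigma ?H (\<lambda>f. nbrs adj V (f u)).
        (fst p)(w := snd p) = f \<and> h f \<le> h (fst p)"
    proof
      fix f assume f: "f \<in> homs adj V E W"
      \<comment> \<open>The restriction of \<open>f\<close> to \<open>W - {w}\<close>; the value \<open>undefined\<close> keeps it extensional.\<close>
      let ?g = "f(w := undefined)"
      have "?g \<in> (W - {w}) \<rightarrow>\<^sub>E V"
        using f \<open>w \<in> W\<close> by (auto simp: homs_def PiE_iff extensional_def)
      then have "(?g, f w) \<in> Sigma ?H (\<lambda>f. nbrs adj V (f u))"
        using f w by (auto simp: homs_def nbrs_def)
      moreover have "(fst (?g, f w))(w := snd (?g, f w)) = f" by simp
      ultimately show "\<exists>p\<in>Sigma ?H (\<lambda>f. nbrs adj V (f u)).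
          (fst p)(w := snd p) = f \<and> h f \<le> h (fst p)"
        using h by (metis fst_conv order_refl)
    qed
  qed (use assms in \<open>auto simp: finite_homs\<close>)
  also have "\<dots> = (\<Sum>f\<in>?H. real (card (nbrs adj V (f u))) * h f)"
    using sum.Sigma[of ?H "\<lambda>f. nbrs adj V (f u)" "\<lambda>f y. h f"] assms
    by (simp add: finite_homs split_beta)
  finally show ?thesis .
qed

text \<open>
  For \<open>s = 0\<close> this is the domination by stars: the right-hand side then counts the homomorphisms of
  the star with \<open>k\<close> edges. The weight \<open>s\<close> at the marked vertex \<open>v\<close> collects the edges already deleted, so
  that \<open>s + k\<close> is constant along the induction, and \<open>v\<close> has to be arbitrary because the weight
  may move to the neighbour of the deleted vertex.
\<close>

lemma sum_homs_le_sum_degree_power: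
  fixes adj :: "'b \<Rightarrow> 'b \<Rightarrow> bool" and V :: "'b set"
  defines "deg \<equiv> \<lambda>x. real (card (nbrs adj V x))"
  assumes "finite V" "finite W" "cut_connected E W" "v \<in> W" "card W = Suc k"
  shows "(\<Sum>f\<in>homs adj V E W. deg (f v) ^ s) \<le> (\<Sum>x\<in>V. deg x ^ (s + k))"
  using assms(3-)
proof (induction k arbitrary: W v s)
  case 0
  then have W: "W = {v}" by (auto simp: card_Suc_eq)
  show ?case
  proof (rule sum_le_included[where i = "\<lambda>x. \<lambda>z\<in>{v}. x"])
    show "\<forall>f\<in>homs adj V E W. \<exists>x\<in>V. (\<lambda>z\<in>{v}. x) = f \<and> deg (f v) ^ s \<le> deg x ^ (s + 0)"
    proof
      fix f assume "f \<in> homs adj V E W"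
      then have "f v \<in> V" "(\<lambda>z\<in>{v}. f v) = f"
        by (auto simp: homs_def W PiE_iff extensional_def fun_eq_iff)
      then show "\<exists>x\<in>V. (\<lambda>z\<in>{v}. x) = f \<and> deg (f v) ^ s \<le> deg x ^ (s + 0)" by auto
    qed
  qed (use 0 \<open>finite V\<close> in \<open>auto simp: finite_homs deg_def\<close>)
next
  case (Suc k)
  then have "W \<noteq> {v}" by auto
  then obtain u w where w: "w \<in> W" "w \<noteq> v" "u \<in> W - {w}" "{u, w} \<in> E" "cut_connected E (W - {w})"
    using removable_vertex Suc.prems by metis
  let ?H = "homs adj V E (W - {w})" and ?X = "\<Sum>x\<in>V. deg x ^ (s + Suc k)"
  have IH: "(\<Sum>f\<in>?H. deg (f z) ^ (s + 1)) \<le> ?X" if "z \<in> W - {w}" for z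
    using Suc.IH[of "W - {w}" z "s + 1"] that w Suc.prems by simp
  have "(\<Sum>f\<in>homs adj V E W. deg (f v) ^ s) \<le> (\<Sum>f\<in>?H. deg (f u) * deg (f v) ^ s)"
    unfolding deg_def
    using sum_homs_remove_vertex[OF \<open>finite V\<close> \<open>finite W\<close> w(1,3,4), of "\<lambda>f. real (card (nbrs adj V (f v))) ^ s" adj] w
    by simp
  then have "(real s + 1) * (\<Sum>f\<in>homs adj V E W. deg (f v) ^ s)
      \<le> (real s + 1) * (\<Sum>f\<in>?H. deg (f u) * deg (f v) ^ s)"
    by (intro mult_left_mono) auto
  also have "\<dots> = (\<Sum>f\<in>?H. (real s + 1) * (deg (f v) ^ s * deg (f u)))"
    by (simp add: sum_distrib_left mult_ac)
  also have "\<dots> \<le> (\<Sum>f\<in>?H. real s * deg (f v) ^ (s + 1) + deg (f u) ^ (s + 1))"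
    by (intro sum_mono weighted_power_le) (auto simp: deg_def)
  also have "\<dots> = real s * (\<Sum>f\<in>?H. deg (f v) ^ (s + 1)) + (\<Sum>f\<in>?H. deg (f u) ^ (s + 1))"
    by (simp only: sum.distrib sum_distrib_left)
  also have "\<dots> \<le> real s * ?X + ?X"
    using w Suc.prems by (intro add_mono mult_left_mono IH) auto
  also have "\<dots> = (real s + 1) * ?X" by (simp add: algebra_simps)
  finally show ?case by (rule mult_left_le_imp_le) simp
qed

section \<open>Counting across a Durfee cut\<close>

lemma card_nbrs_split:
  assumes "finite V" "S \<subseteq> V"
  shows "card (nbrs adj V v) = card (nbrs adj S v) + card (nbrs adj (V - S) v)"
proof -
  have "nbrs adj V v = nbrs adj S v \<union> nbrs adj (V - S) v"
    using assms by (auto simp: nbrs_def)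
  moreover have "nbrs adj S v \<inter> nbrs adj (V - S) v = {}"
    by (auto simp: nbrs_def)
  ultimately show ?thesis
    using assms by (simp add: card_Un_disjoint finite_subset)
qed

text \<open>
  The side of the Durfee square of the sequence \<open>d\<close>: the largest \<open>s\<close> such that at least
  \<open>s\<close> entries are at least \<open>s\<close>. Fewer than \<open>s + 1\<close> entries exceed \<open>s\<close>, so \<open>s\<close>
  elements can be chosen between these two level sets.
\<close>

lemma durfee_set:
  fixes d :: "'b \<Rightarrow> nat"
  assumes "finite V"
  obtains S where "S \<subseteq> V" "\<And>v. v \<in> S \<Longrightarrow> card S \<le> d v" "\<And>u. u \<in> V - S \<Longrightarrow> d u \<le> card S"
proof -
  let ?P = "\<lambda>s. s \<le> card {v \<in> V. s \<le> d v}"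
  have bound: "s \<le> card V" if "?P s" for s
    using that card_mono[OF \<open>finite V\<close>, of "{v \<in> V. s \<le> d v}"] by fastforce
  define s where "s = (GREATEST s. ?P s)"
  have "?P s"
    unfolding s_def using bound by (intro GreatestI_nat[where P = ?P and k = 0]) auto
  have "\<not> ?P (Suc s)"
    unfolding s_def using bound Greatest_le_nat[where P = ?P and k = "Suc s"] s_def
    by (metis Suc_n_not_le_n)
  then have "card {v \<in> V. Suc s \<le> d v} \<le> s" by simp
  moreover have "{v \<in> V. Suc s \<le> d v} \<subseteq> {v \<in> V. s \<le> d v}" by auto
  ultimately obtain S where S: "{v \<in> V. Suc s \<le> d v} \<subseteq> S" "S \<subseteq> {v \<in> V. s \<le> d v}" "card S = s"
    using exists_subset_between[of "{v \<in> V. Suc s \<le> d v}" s "{v \<in> V. s \<le> d v}"]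
      \<open>?P s\<close> \<open>finite V\<close> by auto
  show thesis
  proof (rule that[of S])
    fix u assume "u \<in> V - S"
    with S show "d u \<le> card S" by (force simp: not_less_eq_eq[symmetric])
  qed (use S in auto)
qed

lemma sum_card_nbrs_swap:
  assumes "finite S" "finite R" "symp adj"
  shows "(\<Sum>v\<in>S. card (nbrs adj R v)) = (\<Sum>u\<in>R. card (nbrs adj S u))"
proof -
  have "nbrs adj S u = {v \<in> S. adj v u}" for u
    using \<open>symp adj\<close> by (auto simp: nbrs_def symp_def)
  then show ?thesis
    using assms by (simp add: nbrs_def sum_multicount_gen)
qed

text \<open>
  Both sides count the paths of length two with midpoint in \<open>S\<close> and ends in \<open>R\<close>, where the
  ends may coincide.
\<close>

lemma sum_card_nbrs_squared:
  assumes "finite S" "finite R" "symp adj"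
  shows "(\<Sum>v\<in>S. real (card (nbrs adj R v)) ^ 2)
    = (\<Sum>u\<in>R. \<Sum>u'\<in>R. real (card (nbrs adj S u \<inter> nbrs adj S u')))"
proof -
  let ?i = "\<lambda>v u. if adj v u then 1 else (0::real)"
  have card_R: "real (card (nbrs adj R v)) = (\<Sum>u\<in>R. ?i v u)" for v
    using \<open>finite R\<close> by (simp add: nbrs_def sum.If_cases Int_def)
  have card_S: "(\<Sum>v\<in>S. ?i v u * ?i v u') = real (card (nbrs adj S u \<inter> nbrs adj S u'))" for u u'
  proof -
    have "(\<Sum>v\<in>S. ?i v u * ?i v u') = (\<Sum>v\<in>S. if adj v u \<and> adj v u' then 1 else 0)"
      by (rule sum.cong) auto
    also have "\<dots> = real (card {v \<in> S. adj v u \<and> adj v u'})"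
      using \<open>finite S\<close> by (simp add: sum.If_cases Int_def)
    also have "{v \<in> S. adj v u \<and> adj v u'} = nbrs adj S u \<inter> nbrs adj S u'"
      using \<open>symp adj\<close> by (auto simp: nbrs_def symp_def)
    finally show ?thesis .
  qed
  have "(\<Sum>v\<in>S. real (card (nbrs adj R v)) ^ 2) = (\<Sum>v\<in>S. \<Sum>u\<in>R. \<Sum>u'\<in>R. ?i v u * ?i v u')"
    unfolding card_R power2_eq_square sum_product ..
  also have "\<dots> = (\<Sum>u\<in>R. \<Sum>v\<in>S. \<Sum>u'\<in>R. ?i v u * ?i v u')"
    by (rule sum.swap)
  also have "\<dots> = (\<Sum>u\<in>R. \<Sum>u'\<in>R. \<Sum>v\<in>S. ?i v u * ?i v u')"
    by (intro sum.cong refl sum.swap)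
  finally show ?thesis unfolding card_S .
qed

text \<open>
  If every vertex of \<open>R\<close> were joined to all or none of \<open>S\<close>, the degrees in \<open>S\<close> would
  be constant, and the first summand alone would bound the left-hand side, by equality in the Cauchy-Schwarz
  inequality. The second summand is the price of the vertices of \<open>R\<close> joined to only a part of
  \<open>S\<close>.
\<close>

lemma bipartite_second_moment:
  assumes "finite S" "finite R" "symp adj"
  shows "real (card S) * (\<Sum>v\<in>S. real (card (nbrs adj R v)) ^ 2)
    \<le> (\<Sum>u\<in>R. real (card (nbrs adj S u))) ^ 2
      + real (card R) * (\<Sum>u\<in>R. real (card (nbrs adj S u)) * (real (card S) - real (card (nbrs adj S u))))"
proof -
  let ?s = "real (card S)" and ?g = "\<lambda>u. real (card (nbrs adj S u))"
  have "?s * real (card (nbrs adj S u \<inter> nbrs adj S u')) \<le> ?g u * ?g u' + ?g u * (?s - ?g u)" for u u'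
  proof -
    let ?i = "real (card (nbrs adj S u \<inter> nbrs adj S u'))"
    have i: "?i \<le> ?g u" "?i \<le> ?g u'"
      using \<open>finite S\<close> by (auto intro!: card_mono)
    have g: "?g u \<le> ?s" using card_nbrs_le[OF \<open>finite S\<close>] by simp
    show ?thesis
    proof (cases "?g u \<le> ?g u'")
      case True
      have "?s * ?i \<le> ?s * ?g u" using i by (intro mult_left_mono) auto
      moreover have "?g u * ?g u \<le> ?g u * ?g u'" using True by (intro mult_left_mono) auto
      ultimately show ?thesis by (simp add: algebra_simps)
    next
      case False
      have "?s * ?i \<le> ?s * ?g u'" using i by (intro mult_left_mono) auto
      moreover have "0 \<le> (?s - ?g u) * (?g u - ?g u')" using False g by simp
      ultimately show ?thesis by (simp add: algebra_simps)
    qed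
  qed
  then have "?s * (\<Sum>v\<in>S. real (card (nbrs adj R v)) ^ 2)
      \<le> (\<Sum>u\<in>R. \<Sum>u'\<in>R. ?g u * ?g u' + ?g u * (?s - ?g u))"
    unfolding sum_card_nbrs_squared[OF assms] sum_distrib_left by (intro sum_mono)
  also have "\<dots> = (\<Sum>u\<in>R. ?g u) ^ 2 + real (card R) * (\<Sum>u\<in>R. ?g u * (?s - ?g u))"
    by (simp add: sum.distrib power2_eq_square sum_product sum_distrib_left[symmetric])
  finally show ?thesis .
qed

section \<open>Degree powers in dense graphs\<close>

text \<open>
  A Taylor estimate: on \<open>[0,1]\<close> the second derivative of \<open>t \<mapsto> t\<^bsup>m+2\<^esup>\<close> is at most
  \<open>(m + 2) (m + 1)\<close>. It bounds the powers of the degrees in the Durfee set from above.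
\<close>

lemma power_add_le_quadratic:
  fixes c t :: real
  assumes "0 \<le> c" "0 \<le> t" "c + t \<le> 1"
  shows "(c + t) ^ (m + 2) \<le> c ^ (m + 2) + (real m + 2) * c ^ (m + 1) * t
    + (real m + 2) * (real m + 1) / 2 * t\<^sup>2"
proof (induction m)
  case 0
  show ?case by (simp add: power2_eq_square algebra_simps)
next
  case (Suc m)
  let ?q = "(real m + 2) * (real m + 1) / 2 * t\<^sup>2"
  have 1: "(c + t) * ?q \<le> 1 * ?q"
    using assms by (intro mult_right_mono) auto
  have 2: "c ^ (m + 1) * ((real m + 2) * t\<^sup>2) \<le> 1 * ((real m + 2) * t\<^sup>2)"
    using assms by (intro mult_right_mono power_le_one) auto
  have "(c + t) ^ (Suc m + 2) = (c + t) * (c + t) ^ (m + 2)" by simp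
  also have "\<dots> \<le> (c + t) * (c ^ (m + 2) + (real m + 2) * c ^ (m + 1) * t + ?q)"
    using assms Suc.IH by (intro mult_left_mono) auto
  also have "\<dots> = c ^ (m + 3) + (real m + 3) * c ^ (m + 2) * t + c ^ (m + 1) * ((real m + 2) * t\<^sup>2)
      + (c + t) * ?q"
  proof -
    have "c ^ (m + 2) = c * c ^ (m + 1)" "c ^ (m + 3) = c * (c * c ^ (m + 1))"
      by (simp_all add: numeral_eq_Suc)
    then show ?thesis by (simp only:) (simp add: field_simps power2_eq_square)
  qed
  also have "\<dots> \<le> c ^ (m + 3) + (real m + 3) * c ^ (m + 2) * t + (real m + 2) * t\<^sup>2 + ?q"
    using 1 2 by linarith
  also have "\<dots> = c ^ (Suc m + 2) + (real (Suc m) + 2) * c ^ (Suc m + 1) * t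
      + (real (Suc m) + 2) * (real (Suc m) + 1) / 2 * t\<^sup>2"
    by (simp add: algebra_simps numeral_3_eq_3)
  finally show ?case .
qed

text \<open>
  With \<open>w\<^sup>2\<close> as the variable, this is a second order Taylor estimate for
  \<open>t \<mapsto> t\<^bsup>(m+3)/2\<^esup>\<close> at \<open>c\<^sup>2\<close>. It is the lower bound for the right-hand side of the degree
  power inequality, where \<open>w\<^sup>2\<close> is the mean degree; the quadratic term is the gain that has to
  absorb the squared excesses. Working with \<open>w\<close> keeps the exponents integral.
\<close>

lemma power_ge_quadratic_in_square:
  fixes c w :: real
  assumes "0 \<le> c" "c \<le> w" "w \<le> 1"
  shows "c ^ (m + 3) + (real m + 3) / 2 * c ^ (m + 1) * (w\<^sup>2 - c\<^sup>2)
      + (real m + 3) * (real m + 1) / 8 * c ^ m * (w\<^sup>2 - c\<^sup>2)\<^sup>2 \<le> w ^ (m + 3)"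
proof -
  define a b where "a = (real m + 3) / 2 * c ^ (m + 1)" and "b = (real m + 3) * (real m + 1) / 8 * c ^ m"
  define F where "F x = x ^ (m + 3) - a * (x\<^sup>2 - c\<^sup>2) - b * (x\<^sup>2 - c\<^sup>2)\<^sup>2" for x
  define D where "D x = (real m + 3) * x ^ (m + 2) - a * (2 * x) - b * (2 * (x\<^sup>2 - c\<^sup>2) * (2 * x))" for x
  have "F c \<le> F w"
  proof (rule DERIV_nonneg_imp_nondecreasing[OF \<open>c \<le> w\<close>])
    fix x assume x: "c \<le> x" "x \<le> w"
    have "(F has_real_derivative D x) (at x)"
      unfolding F_def D_def
      by (auto intro!: derivative_eq_intros)
    moreover have "0 \<le> D x"
    proof -
      have "(real m + 1) * c ^ m * (x\<^sup>2 - c\<^sup>2) = (real m + 1) * c ^ m * (x - c) * (x + c)"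
        by (simp add: power2_eq_square algebra_simps)
      also have "\<dots> \<le> (real m + 1) * c ^ m * (x - c) * 2"
        using x assms by (intro mult_left_mono) auto
      also have "\<dots> \<le> (x ^ (m + 1) - c ^ (m + 1)) * 2"
        using power_diff_ge_tangent[of c x m] x assms by (intro mult_right_mono) auto
      finally have "0 \<le> (real m + 3) * x * ((x ^ (m + 1) - c ^ (m + 1)) * 2 - (real m + 1) * c ^ m * (x\<^sup>2 - c\<^sup>2))"
        using x assms by (intro mult_nonneg_nonneg) auto
      also have "\<dots> = 2 * ((real m + 3) * x ^ (m + 2)) - (2 * a) * (2 * x) - (8 * b) * ((x\<^sup>2 - c\<^sup>2) * x)"
      proof -
        have a2: "2 * a = (real m + 3) * c ^ (m + 1)" and b8: "8 * b = (real m + 3) * (real m + 1) * c ^ m"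
          by (simp_all add: a_def b_def)
        show ?thesis unfolding a2 b8 by (simp add: algebra_simps)
      qed
      also have "\<dots> = 2 * D x"
        unfolding D_def by (simp add: algebra_simps)
      finally show ?thesis by simp
    qed
    ultimately show "\<exists>y. DERIV F x :> y \<and> 0 \<le> y" by blast
  qed
  then show ?thesis unfolding F_def a_def b_def by simp
qed

text \<open>
  Outside the Durfee set a vertex has degree \<open>d \<le> c\<close>, of which \<open>g\<close> goes to the Durfee set.
  By convexity \<open>d\<^bsup>m+2\<^esup>\<close> lies below the chord \<open>c\<^bsup>m+1\<^esup> d\<close>. At \<open>g\<close> the gap is at least
  \<open>c\<^sup>m g (c - g)\<close>, and between \<open>g\<close> and \<open>d\<close> it shrinks with slope at most
  \<open>(m + 1) c\<^bsup>m+1\<^esup>\<close>. Using only half of this estimate, averaged with the chord, is deliberate: the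
  last term is then exactly what the edges outside the Durfee set can pay for, since
  they contribute to the mean degree with coefficient \<open>(m + 3) / 2 = 1 + (m + 1) / 2\<close>.
\<close>

lemma low_degree_power_le:
  fixes c d g :: real
  assumes "0 \<le> g" "g \<le> d" "d \<le> c"
  shows "d ^ (m + 2) \<le> c ^ (m + 1) * d - c ^ m * (g * (c - g)) / 2 + (real m + 1) / 2 * c ^ (m + 1) * (d - g)"
proof -
  have "d ^ (m + 1) * d \<le> c ^ (m + 1) * d"
    using assms by (intro mult_right_mono power_mono) auto
  then have 1: "d ^ (m + 2) \<le> c ^ (m + 1) * d" by (simp add: algebra_simps)
  have "g ^ m * g\<^sup>2 \<le> c ^ m * g\<^sup>2"
    using assms by (intro mult_right_mono power_mono) auto
  then have 2: "g ^ (m + 2) \<le> c ^ (m + 1) * g - c ^ m * (g * (c - g))"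
    by (simp add: algebra_simps power2_eq_square)
  have "d ^ (m + 2) - g ^ (m + 2) \<le> (real m + 2) * d ^ (m + 1) * (d - g)"
    using power_diff_le_tangent[of g d "m + 1"] assms by (simp add: add.commute)
  also have "\<dots> \<le> (real m + 2) * c ^ (m + 1) * (d - g)"
    using assms by (intro mult_left_mono mult_right_mono power_mono) auto
  finally have "d ^ (m + 2) \<le> c ^ (m + 1) * d - c ^ m * (g * (c - g)) + (real m + 1) * c ^ (m + 1) * (d - g)"
    using 2 by (simp add: algebra_simps)
  with 1 show ?thesis by (simp add: field_simps)
qed

text \<open>
  The quadratic loss from the excesses is covered by three gains. In the notation of
  \<open>sum_degree_power_le\<close> below, \<open>M\<close> bounds the second moment of the excesses, \<open>B\<close> is their
  sum, \<open>e\<close> counts the edges leaving the Durfee set, \<open>C\<close> is the degree sum outside, and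
  \<open>Q\<close> is the price term of \<open>bipartite_second_moment\<close>. After multiplication with \<open>c\<close>, the
  loss consists of \<open>(m + 2) (m + 1) / 2 \<cdot> e\<^sup>2\<close> and a small multiple of \<open>Q\<close>. The gain
  from \<open>(B + C)\<^sup>2 \<ge> 4 B e\<close> has the slightly larger coefficient
  \<open>(m + 3) (m + 1) / 2\<close> at \<open>B e = e\<^sup>2 - e (e - B)\<close>, and the deficit \<open>e (e - B)\<close> is
  covered by the linear gain because \<open>e \<le> 1 - c\<close> is small.
\<close>

lemma excess_moment_le:
  fixes c B C e M Q :: real
  assumes c: "c \<le> 1" "(real m + 3)\<^sup>2 * (1 - c) \<le> 1"
    and M: "c * M \<le> e\<^sup>2 + (1 - c) * Q" and "0 \<le> Q"
    and "0 \<le> B" "B \<le> e" "e \<le> C" "e \<le> 1 - c"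
  shows "(real m + 2) * (real m + 1) / 2 * M
    \<le> c ^ m * Q / 2 + (real m + 1) / 2 * c ^ (m + 1) * (e - B)
      + (real m + 3) * (real m + 1) / 8 * c ^ m * (B + C)\<^sup>2"
proof -
  define q where "q = c ^ (m + 1)"
  have "1 * (1 - c) \<le> (real m + 3)\<^sup>2 * (1 - c)"
    using c by (intro mult_right_mono) (auto simp: power2_eq_square algebra_simps)
  have gap: "1 - c \<le> 1 / (real m + 3)\<^sup>2"
    using c by (simp add: field_simps)
  also have "\<dots> < 1"
    using power_strict_mono[of 1 "real m + 3" 2] by (simp add: field_simps)
  finally have "0 < c" by simp
  have "0 < q" "q \<le> 1" using \<open>0 < c\<close> \<open>c \<le> 1\<close> unfolding q_def by (simp, intro power_le_one) auto
  have "1 + real (m + 1) * (c - 1) \<le> (1 + (c - 1)) ^ (m + 1)"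
    using \<open>0 < c\<close> by (intro Bernoulli_inequality) auto
  then have "1 - (real m + 1) * (1 - c) \<le> q"
    unfolding q_def by (simp add: algebra_simps)
  moreover have "(real m + 1) * (1 - c) \<le> (real m + 1) * (1 / (real m + 3)\<^sup>2)"
    using gap by (intro mult_left_mono) auto
  moreover have "(real m + 1) * (1 / (real m + 3)\<^sup>2) \<le> 1 / (real m + 3)"
    by (simp add: divide_le_eq le_divide_eq power2_eq_square)
  ultimately have "1 - 1 / (real m + 3) \<le> q" by linarith
  then have q_lower: "real m + 2 \<le> (real m + 3) * q"
    by (simp add: field_simps)
  have Q_coeff: "(real m + 2) * (real m + 1) * (1 - c) \<le> q"
  proof -
    have "(real m + 2) * (real m + 1) * (1 - c) \<le> (real m + 2) * (real m + 3) * (1 - c)"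
      using c by (intro mult_right_mono mult_left_mono) auto
    then have "(real m + 3) * ((real m + 2) * (real m + 1) * (1 - c)) \<le> (real m + 2) * ((real m + 3)\<^sup>2 * (1 - c))"
      using mult_left_mono[of _ _ "real m + 3"] by (fastforce simp: power2_eq_square algebra_simps)
    also have "\<dots> \<le> (real m + 2) * 1"
      using c by (intro mult_left_mono) auto
    also have "\<dots> \<le> (real m + 3) * q"
      using q_lower by simp
    finally show ?thesis by (rule mult_left_le_imp_le) simp
  qed
  have e_coeff: "(real m + 3) * e \<le> c"
  proof -
    have "(real m + 3) * e \<le> (real m + 3) * (1 - c)"
      using assms by (intro mult_left_mono) auto
    moreover have "(real m + 4) * (1 - c) \<le> (real m + 3)\<^sup>2 * (1 - c)"
      using c by (intro mult_right_mono) (auto simp: power2_eq_square algebra_simps)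
    ultimately show ?thesis using c by (simp add: algebra_simps)
  qed
  have "0 \<le> (e - B)\<^sup>2" by simp
  moreover have "(B + e)\<^sup>2 \<le> (B + C)\<^sup>2"
    using assms by (intro power_mono) auto
  ultimately have square: "4 * e\<^sup>2 - 4 * (e * (e - B)) \<le> (B + C)\<^sup>2"
    by (simp add: power2_eq_square algebra_simps)
  have "c * ((real m + 2) * (real m + 1) / 2 * M) = (real m + 2) * (real m + 1) / 2 * (c * M)"
    by simp
  also have "\<dots> \<le> (real m + 2) * (real m + 1) / 2 * (e\<^sup>2 + (1 - c) * Q)"
    using M by (intro mult_left_mono) auto
  also have "\<dots> = (real m + 2) * (real m + 1) * (1 - c) * (Q / 2) + (real m + 2) * ((real m + 1) / 2 * e\<^sup>2)"
    by (simp add: algebra_simps add_divide_distrib diff_divide_distrib)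
  also have "\<dots> \<le> q * (Q / 2) + (real m + 3) * q * ((real m + 1) / 2 * e\<^sup>2)"
    using \<open>0 \<le> Q\<close> by (intro add_mono mult_right_mono Q_coeff q_lower) auto
  also have "(real m + 3) * q * ((real m + 1) / 2 * e\<^sup>2)
      = (real m + 3) * e * ((real m + 1) / 2 * q * (e - B))
        + (real m + 3) * (real m + 1) / 8 * q * (4 * e\<^sup>2 - 4 * (e * (e - B)))"
    by (simp add: field_simps power2_eq_square)
  also have "\<dots> \<le> c * ((real m + 1) / 2 * q * (e - B)) + (real m + 3) * (real m + 1) / 8 * q * (B + C)\<^sup>2"
    using assms \<open>0 < q\<close> by (intro add_mono mult_right_mono[OF e_coeff] mult_left_mono[OF square]) auto
  finally have "c * ((real m + 2) * (real m + 1) / 2 * M)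
    \<le> c * (c ^ m * Q / 2 + (real m + 1) / 2 * c ^ (m + 1) * (e - B)
      + (real m + 3) * (real m + 1) / 8 * c ^ m * (B + C)\<^sup>2)"
    by (simp add: q_def algebra_simps)
  then show ?thesis
    using \<open>0 < c\<close> by (simp only: mult_le_cancel_left_pos)
qed

text \<open>
  The exponent is written \<open>m + 2\<close> because the expansion involves the powers \<open>m\<close> and \<open>m + 1\<close>
  of \<open>c\<close>. All quantities are divided by \<open>n\<close>: vertex sums become averages over \<open>V\<close>, and
  the mean degree is \<open>c\<^sup>2 + B + C\<close>.
\<close>

lemma sum_degree_power_le:
  fixes V :: "'b set" and adj :: "'b \<Rightarrow> 'b \<Rightarrow> bool"
  defines "deg \<equiv> \<lambda>v. real (card (nbrs adj V v))"
  assumes "finite V" "symp adj"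
    and dense: "(1 - 1 / (real m + 3) ^ 4) * (real (card V))\<^sup>2 \<le> (\<Sum>v\<in>V. deg v)"
  shows "(\<Sum>v\<in>V. deg v ^ (m + 2)) \<le> sqrt (\<Sum>v\<in>V. deg v) ^ (m + 3)"
proof (cases "V = {}")
  case False
  define n where "n = real (card V)"
  have "0 < n" using False \<open>finite V\<close> by (simp add: n_def card_gt_0_iff)
  obtain S where S: "S \<subseteq> V"
    and high: "\<And>v. v \<in> S \<Longrightarrow> card S \<le> card (nbrs adj V v)"
    and low: "\<And>u. u \<in> V - S \<Longrightarrow> card (nbrs adj V u) \<le> card S"
    using durfee_set[OF \<open>finite V\<close>, of "\<lambda>v. card (nbrs adj V v)"] by metis
  define R where "R = V - S"
  have fin: "finite S" "finite R" using S \<open>finite V\<close> by (auto simp: R_def finite_subset)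
  define c where "c = real (card S) / n"
  define d where "d v = deg v / n" for v
  define r where "r v = real (card (nbrs adj R v)) / n" for v
  define g where "g u = real (card (nbrs adj S u)) / n" for u
  have S_card: "real (card S) = c * n" using \<open>0 < n\<close> by (simp add: c_def)
  have R_card: "real (card R) = (1 - c) * n"
    using S \<open>finite V\<close> \<open>0 < n\<close> card_mono[OF \<open>finite V\<close> S]
    by (simp add: R_def c_def card_Diff_subset finite_subset of_nat_diff left_diff_distrib flip: n_def)
  have split: "(\<Sum>v\<in>V. f v) = (\<Sum>v\<in>S. f v) + (\<Sum>v\<in>R. f v)" for f :: "'b \<Rightarrow> real"
    using S \<open>finite V\<close> by (simp add: R_def sum.subset_diff add.commute)
  have c: "0 \<le> c" "c \<le> 1"
    using card_mono[OF \<open>finite V\<close> S] \<open>0 < n\<close> by (auto simp: c_def n_def)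
  have d_le_1: "d v \<le> 1" for v
    using card_nbrs_le[OF \<open>finite V\<close>, of adj v] \<open>0 < n\<close> by (simp add: d_def deg_def n_def)
  have d_S: "c \<le> d v" if "v \<in> S" for v
    using high[OF that] \<open>0 < n\<close> by (simp add: c_def d_def deg_def field_simps)
  have d_R: "d u \<le> c" if "u \<in> R" for u
    using low[of u] that \<open>0 < n\<close> by (simp add: c_def d_def deg_def field_simps R_def)
  have d_split: "d v = g v + r v" for v
    using card_nbrs_split[OF \<open>finite V\<close> S, of adj v]
    by (simp add: d_def deg_def g_def r_def R_def add_divide_distrib)
  have nonneg: "0 \<le> g v" "0 \<le> r v" for v
    using \<open>0 < n\<close> by (simp_all add: g_def r_def)
  have g_le: "g v \<le> c" for v
    using card_nbrs_le[OF \<open>finite S\<close>, of adj v] \<open>0 < n\<close> by (simp add: g_def c_def field_simps)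
  define B where "B = (\<Sum>v\<in>S. d v - c) / n"
  define C where "C = (\<Sum>u\<in>R. d u) / n"
  define e where "e = (\<Sum>u\<in>R. g u) / n"
  define M where "M = (\<Sum>v\<in>S. (r v)\<^sup>2) / n"
  define Q where "Q = (\<Sum>u\<in>R. g u * (c - g u)) / n"
  define w where "w = sqrt ((\<Sum>v\<in>V. d v) / n)"
  have e_S: "e = (\<Sum>v\<in>S. r v) / n"
    using sum_card_nbrs_swap[OF fin \<open>symp adj\<close>]
    by (simp add: e_def g_def r_def sum_divide_distrib[symmetric] flip: of_nat_sum)
  have "(\<Sum>v\<in>S. d v) = n * B + c * c * n"
    using \<open>0 < n\<close> by (simp add: B_def sum_subtractf S_card)
  then have mean: "(\<Sum>v\<in>V. d v) / n = c\<^sup>2 + (B + C)"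
    using \<open>0 < n\<close> by (simp add: split C_def field_simps power2_eq_square)
  have "0 \<le> B" using \<open>0 < n\<close> d_S by (auto simp: B_def intro!: divide_nonneg_pos sum_nonneg)
  have "B \<le> e"
    unfolding B_def e_S using \<open>0 < n\<close> d_split g_le
    by (intro divide_right_mono sum_mono) (auto simp: algebra_simps)
  have "0 \<le> e" unfolding e_def using \<open>0 < n\<close> nonneg by (auto intro!: divide_nonneg_pos sum_nonneg)
  have "e \<le> C"
    unfolding C_def e_def using \<open>0 < n\<close> d_split nonneg by (intro divide_right_mono sum_mono) auto
  have "e \<le> 1 - c"
  proof -
    have "(\<Sum>u\<in>R. g u) \<le> (\<Sum>u\<in>R. 1)"
      using g_le c by (intro sum_mono) (auto intro: order_trans)
    then show ?thesis
      using \<open>0 < n\<close> by (simp add: e_def R_card field_simps)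
  qed
  have "0 \<le> Q" unfolding Q_def using \<open>0 < n\<close> nonneg g_le by (auto intro!: divide_nonneg_pos sum_nonneg)
  have moment: "c * M \<le> e\<^sup>2 + (1 - c) * Q"
  proof -
    have "(\<Sum>v\<in>S. real (card (nbrs adj R v)) ^ 2) = n ^ 3 * M"
      using \<open>0 < n\<close> by (simp add: M_def r_def power_divide sum_divide_distrib[symmetric] power2_eq_square power3_eq_cube)
    moreover have "(\<Sum>u\<in>R. real (card (nbrs adj S u))) = n\<^sup>2 * e"
      using \<open>0 < n\<close> by (simp add: e_def g_def sum_divide_distrib[symmetric] power2_eq_square)
    moreover have "(\<Sum>u\<in>R. real (card (nbrs adj S u)) * (real (card S) - real (card (nbrs adj S u)))) = n ^ 3 * Q"
    proof -
      have "real (card (nbrs adj S u)) * (real (card S) - real (card (nbrs adj S u))) = n\<^sup>2 * (g u * (c - g u))" for u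
        using \<open>0 < n\<close> by (simp add: g_def c_def field_simps power2_eq_square)
      then show ?thesis
        using \<open>0 < n\<close> by (simp add: Q_def sum_distrib_left[symmetric] power2_eq_square power3_eq_cube)
    qed
    ultimately have "c * n * (n ^ 3 * M) \<le> (n\<^sup>2 * e)\<^sup>2 + (1 - c) * n * (n ^ 3 * Q)"
      using bipartite_second_moment[OF fin \<open>symp adj\<close>] by (simp add: S_card R_card)
    then have "n ^ 4 * (c * M) \<le> n ^ 4 * (e\<^sup>2 + (1 - c) * Q)"
      by (simp add: algebra_simps numeral_eq_Suc)
    then show ?thesis using \<open>0 < n\<close> by simp
  qed
  \<comment> \<open>The complement of \<open>S\<close> has measure \<open>1 - c\<close>, and its vertices miss at least \<open>1 - c\<close> each; so a mean degree near \<open>1\<close> forces \<open>c\<close> to be near \<open>1\<close>.\<close>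
  have mean_le: "(\<Sum>v\<in>V. d v) / n \<le> 1 - (1 - c)\<^sup>2"
  proof -
    have "(\<Sum>v\<in>S. d v) \<le> (\<Sum>v\<in>S. 1)" "(\<Sum>u\<in>R. d u) \<le> (\<Sum>u\<in>R. c)"
      using d_le_1 d_R by (auto intro: sum_mono simp del: sum_constant)
    then have "(\<Sum>v\<in>V. d v) \<le> n * (1 - (1 - c)\<^sup>2)"
      by (simp add: split S_card R_card power2_eq_square algebra_simps)
    then show ?thesis using \<open>0 < n\<close> by (simp add: field_simps)
  qed
  have small: "(real m + 3)\<^sup>2 * (1 - c) \<le> 1"
  proof -
    have "1 - 1 / (real m + 3) ^ 4 \<le> (\<Sum>v\<in>V. d v) / n"
      using dense \<open>0 < n\<close>
      by (simp add: d_def sum_divide_distrib[symmetric] field_simps power2_eq_square flip: n_def)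
    with mean_le have "(1 - c)\<^sup>2 \<le> 1 / (real m + 3) ^ 4" by linarith
    then have "(real m + 3) ^ 4 * (1 - c)\<^sup>2 \<le> 1" by (simp add: field_simps)
    then have "((real m + 3)\<^sup>2 * (1 - c))\<^sup>2 \<le> 1\<^sup>2"
      by (simp add: power_mult_distrib flip: power_mult)
    then show ?thesis by (rule power2_le_imp_le) simp
  qed
  have w2: "w\<^sup>2 = c\<^sup>2 + (B + C)"
    using \<open>0 \<le> B\<close> \<open>0 \<le> e\<close> \<open>e \<le> C\<close> by (simp add: w_def mean)
  have "c \<le> w"
    using \<open>0 \<le> B\<close> \<open>0 \<le> e\<close> \<open>e \<le> C\<close> c by (simp add: w_def mean real_le_rsqrt)
  have "(\<Sum>v\<in>V. d v) / n \<le> 1" using mean_le zero_le_power2[of "1 - c"] by linarith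
  then have "w \<le> 1" by (simp add: w_def)
  have sum_S: "(\<Sum>v\<in>S. d v ^ (m + 2)) / n
      \<le> c ^ (m + 3) + (real m + 2) * c ^ (m + 1) * B + (real m + 2) * (real m + 1) / 2 * M"
  proof -
    have "d v ^ (m + 2) \<le> c ^ (m + 2) + (real m + 2) * c ^ (m + 1) * (d v - c)
        + (real m + 2) * (real m + 1) / 2 * (r v)\<^sup>2" if "v \<in> S" for v
    proof -
      have "(d v - c)\<^sup>2 \<le> (r v)\<^sup>2"
        using d_S[OF that] d_split[of v] g_le[of v] by (intro power_mono) auto
      then have "(real m + 2) * (real m + 1) / 2 * (d v - c)\<^sup>2 \<le> (real m + 2) * (real m + 1) / 2 * (r v)\<^sup>2"
        by (intro mult_left_mono) auto
      moreover have shift: "c + (d v - c) = d v" by simp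
      have "d v ^ (m + 2) \<le> c ^ (m + 2) + (real m + 2) * c ^ (m + 1) * (d v - c)
          + (real m + 2) * (real m + 1) / 2 * (d v - c)\<^sup>2"
        using power_add_le_quadratic[of c "d v - c" m, unfolded shift] c d_S[OF that] d_le_1[of v] by simp
      ultimately show ?thesis by linarith
    qed
    then have "(\<Sum>v\<in>S. d v ^ (m + 2)) \<le> (\<Sum>v\<in>S. c ^ (m + 2) + (real m + 2) * c ^ (m + 1) * (d v - c)
        + (real m + 2) * (real m + 1) / 2 * (r v)\<^sup>2)"
      by (rule sum_mono)
    also have "\<dots> = c ^ (m + 2) * (c * n) + (real m + 2) * c ^ (m + 1) * (n * B)
        + (real m + 2) * (real m + 1) / 2 * (n * M)"
      using \<open>0 < n\<close> by (simp only: sum.distrib sum_distrib_left[symmetric] B_def M_def)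
        (simp add: S_card)
    also have "\<dots> = n * (c ^ (m + 3) + (real m + 2) * c ^ (m + 1) * B + (real m + 2) * (real m + 1) / 2 * M)"
      by (simp add: algebra_simps numeral_3_eq_3)
    finally show ?thesis using \<open>0 < n\<close> by (simp add: field_simps)
  qed
  have sum_R: "(\<Sum>u\<in>R. d u ^ (m + 2)) / n
      \<le> c ^ (m + 1) * C - c ^ m * Q / 2 + (real m + 1) / 2 * c ^ (m + 1) * (C - e)"
  proof -
    have "(\<Sum>u\<in>R. d u ^ (m + 2)) \<le> (\<Sum>u\<in>R. c ^ (m + 1) * d u - c ^ m / 2 * (g u * (c - g u))
        + (real m + 1) / 2 * c ^ (m + 1) * (d u - g u))"
    proof (rule sum_mono)
      fix u assume "u \<in> R"
      then show "d u ^ (m + 2) \<le> c ^ (m + 1) * d u - c ^ m / 2 * (g u * (c - g u))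
        + (real m + 1) / 2 * c ^ (m + 1) * (d u - g u)"
        using low_degree_power_le[of "g u" "d u" c m] d_R d_split nonneg by simp
    qed
    also have "\<dots> = n * (c ^ (m + 1) * C - c ^ m / 2 * Q + (real m + 1) / 2 * c ^ (m + 1) * (C - e))"
      using \<open>0 < n\<close>
      by (simp only: sum.distrib sum_subtractf sum_distrib_left[symmetric] C_def Q_def e_def)
        (simp add: field_simps)
    finally show ?thesis using \<open>0 < n\<close> by (simp add: field_simps)
  qed
  have "(\<Sum>v\<in>V. d v ^ (m + 2)) / n \<le> w ^ (m + 3)"
  proof -
    define q where "q = c ^ (m + 1)"
    \<comment> \<open>The linear terms balance exactly.\<close>
    have "(real m + 2) * q * B + (real m + 1) / 2 * q * (e - B) + q * C + (real m + 1) / 2 * q * (C - e)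
        = (real m + 3) / 2 * q * (B + C)"
      by (simp add: field_simps)
    moreover have "c ^ (m + 3) + (real m + 3) / 2 * q * (B + C)
      + (real m + 3) * (real m + 1) / 8 * c ^ m * (B + C)\<^sup>2 \<le> w ^ (m + 3)"
      using power_ge_quadratic_in_square[OF \<open>0 \<le> c\<close> \<open>c \<le> w\<close> \<open>w \<le> 1\<close>, of m] by (simp add: w2 q_def)
    ultimately show ?thesis
      using sum_S sum_R excess_moment_le[OF \<open>c \<le> 1\<close> small moment \<open>0 \<le> Q\<close> \<open>0 \<le> B\<close> \<open>B \<le> e\<close> \<open>e \<le> C\<close> \<open>e \<le> 1 - c\<close>]
      by (simp only: split add_divide_distrib q_def[symmetric])
  qed
  then have "n ^ (m + 3) * ((\<Sum>v\<in>V. d v ^ (m + 2)) / n) \<le> n ^ (m + 3) * w ^ (m + 3)"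
    using \<open>0 < n\<close> by (intro mult_left_mono) auto
  also have "n ^ (m + 3) * w ^ (m + 3) = sqrt (\<Sum>v\<in>V. deg v) ^ (m + 3)"
  proof -
    have "(\<Sum>v\<in>V. d v) / n = (\<Sum>v\<in>V. deg v) / n\<^sup>2"
      by (simp add: d_def sum_divide_distrib[symmetric] power2_eq_square)
    then have "n * w = sqrt (\<Sum>v\<in>V. deg v)"
      using \<open>0 < n\<close> by (simp add: w_def real_sqrt_divide)
    then show ?thesis by (simp flip: power_mult_distrib)
  qed
  also have "n ^ (m + 3) * ((\<Sum>v\<in>V. d v ^ (m + 2)) / n) = (\<Sum>v\<in>V. deg v ^ (m + 2))"
    using \<open>0 < n\<close> by (simp add: d_def power_divide sum_divide_distrib[symmetric] numeral_3_eq_3)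
  finally show ?thesis .
qed simp

section \<open>The upper bound for red/blue cliques\<close>

abbreviation red_adj :: "'b rb \<Rightarrow> 'b \<Rightarrow> 'b \<Rightarrow> bool" where
  "red_adj G x y \<equiv> {x, y} \<in> red G"

lemma symp_red_adj: "symp (red_adj G)"
  by (simp add: symp_def insert_commute)

lemma rb_cliqueD:
  assumes "rb_clique G"
  shows "finite (verts G)" "red G \<subseteq> [verts G]\<^bsup>2\<^esup>" "red G \<union> blue G = [verts G]\<^bsup>2\<^esup>"
  using assms by (auto simp: rb_clique_def rb_graph_def)

lemma sum_red_degree:
  assumes "rb_clique G"
  shows "(\<Sum>v\<in>verts G. card (nbrs (red_adj G) (verts G) v)) = 2 * card (red G)"
proof -
  note G = rb_cliqueD[OF assms]
  have "card (nbrs (red_adj G) (verts G) v) = card {e \<in> red G. v \<in> e}" for v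
  proof (rule bij_betw_same_card[of "\<lambda>u. {v, u}"], rule bij_betw_imageI)
    show "inj_on (\<lambda>u. {v, u}) (nbrs (red_adj G) (verts G) v)"
      by (auto simp: inj_on_def doubleton_eq_iff)
    have "e \<in> (\<lambda>u. {v, u}) ` nbrs (red_adj G) (verts G) v" if e: "e \<in> red G" "v \<in> e" for e
    proof -
      obtain x y where "e = {x, y}" "x \<in> verts G" "y \<in> verts G"
        using e G(2) by (auto elim!: nsets2_E)
      then show ?thesis using e by (auto simp: nbrs_def insert_commute)
    qed
    then show "(\<lambda>u. {v, u}) ` nbrs (red_adj G) (verts G) v = {e \<in> red G. v \<in> e}"
      by (auto simp: nbrs_def)
  qed
  moreover have "card {v \<in> verts G. v \<in> e} = 2" if "e \<in> red G" for e
  proof -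
    have "e \<subseteq> verts G" "card e = 2" using that G(2) by (auto simp: nsets_def)
    moreover from this have "{v \<in> verts G. v \<in> e} = e" by blast
    ultimately show ?thesis by simp
  qed
  moreover have "finite (red G)"
    using G finite_imp_finite_nsets finite_subset by blast
  ultimately show ?thesis
    using sum_multicount[of "verts G" "red G" "(\<in>)" 2] G(1) by simp
qed

text \<open>
  Colour-preserving injections are homomorphisms, so the domination by stars applies with the trivial
  weight \<open>s = 0\<close>.
\<close>

lemma inj_count_le_sum_degree_power:
  assumes T: "simple_graph T" "connected_graph T" and "card (uverts T) = Suc k" and G: "rb_clique G"
  shows "real (inj_count (all_red T) G)
    \<le> (\<Sum>x\<in>verts G. real (card (nbrs (red_adj G) (verts G) x)) ^ k)"
proof -
  let ?H = "homs (red_adj G) (verts G) (uedges T) (uverts T)"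
  have fin: "finite (verts G)" "finite (uverts T)"
    using rb_cliqueD[OF G] T by (auto simp: simple_graph_def)
  obtain v where "v \<in> uverts T" using T by (auto simp: connected_graph_def)
  have "inj_count (all_red T) G \<le> card ?H"
    unfolding inj_count_def all_red_def homs_def
    by (rule card_mono) (use finite_homs[OF fin] in \<open>auto simp: homs_def\<close>)
  also have "real (card ?H) = (\<Sum>f\<in>?H. real (card (nbrs (red_adj G) (verts G) (f v))) ^ 0)"
    by simp
  also have "\<dots> \<le> (\<Sum>x\<in>verts G. real (card (nbrs (red_adj G) (verts G) x)) ^ (0 + k))"
    by (rule sum_homs_le_sum_degree_power) (use fin cut_connected_graph assms \<open>v \<in> uverts T\<close> in auto)
  finally show ?thesis by simp
qed

text \<open>
  The two halves of the argument combined. A single edge is treated apart: there the sum of the degrees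
  is \<open>D = (\<surd>D)\<^sup>2\<close> itself.
\<close>

lemma inj_count_le_sqrt_power:
  assumes T: "simple_graph T" "connected_graph T" "2 \<le> card (uverts T)" and G: "rb_clique G"
    and dense: "(1 - 1 / real (card (uverts T)) ^ 4) * (real (card (verts G)))\<^sup>2 \<le> 2 * real (card (red G))"
  shows "real (inj_count (all_red T) G) \<le> sqrt (2 * real (card (red G))) ^ card (uverts T)"
proof -
  let ?deg = "\<lambda>v. real (card (nbrs (red_adj G) (verts G) v))"
  have sum_deg: "(\<Sum>v\<in>verts G. ?deg v) = 2 * real (card (red G))"
    using sum_red_degree[OF G] by (simp flip: of_nat_sum)
  obtain m where m: "card (uverts T) = Suc (Suc m)"
    using T(3) by (metis add_2_eq_Suc le_Suc_ex)
  have "real (inj_count (all_red T) G) \<le> (\<Sum>v\<in>verts G. ?deg v ^ Suc m)"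
    by (rule inj_count_le_sum_degree_power[OF T(1,2) m G])
  also have "\<dots> \<le> sqrt (2 * real (card (red G))) ^ Suc (Suc m)"
  proof (cases m)
    case 0
    then show ?thesis using sum_deg by simp
  next
    case (Suc m')
    have "(\<Sum>v\<in>verts G. ?deg v ^ (m' + 2)) \<le> sqrt (\<Sum>v\<in>verts G. ?deg v) ^ (m' + 3)"
      by (rule sum_degree_power_le[OF rb_cliqueD(1)[OF G] symp_red_adj])
        (use dense in \<open>simp add: sum_deg m Suc add.commute\<close>)
    then show ?thesis by (simp add: sum_deg Suc numeral_3_eq_3)
  qed
  finally show ?thesis unfolding m .
qed

lemma real_choose_two: "real (n choose 2) = real n * (real n - 1) / 2"
  by (induction n) (simp_all add: numeral_2_eq_2 field_simps)

text \<open>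
  Density is a proportion of unordered pairs, whereas degree sums are compared with \<open>n\<^sup>2\<close>; the two
  differ by a factor \<open>1 - 1/n\<close>.
\<close>

lemma red_density_tendsto:
  assumes "has_density G \<beta>"
  shows "(\<lambda>n. 2 * real (card (red (G n))) / (real n)\<^sup>2) \<longlonglongrightarrow> \<beta>"
proof -
  have G: "rb_clique (G n)" "card (verts (G n)) = n" if "1 \<le> n" for n
    using assms that by (auto simp: has_density_def)
  have lim: "(\<lambda>n. real (card (red (G n))) / real (card (red (G n) \<union> blue (G n)))) \<longlonglongrightarrow> \<beta>"
    using assms by (simp add: has_density_def)
  have "(\<lambda>n::nat. 1 - 1 / real n) \<longlonglongrightarrow> 1 - 0"
    by (intro tendsto_intros lim_1_over_n)
  then have "(\<lambda>n. real (card (red (G n))) / real (card (red (G n) \<union> blue (G n))) * (1 - 1 / real n)) \<longlonglongrightarrow> \<beta> * (1 - 0)"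
    by (intro tendsto_mult lim)
  then have "(\<lambda>n. real (card (red (G n))) / real (card (red (G n) \<union> blue (G n))) * (1 - 1 / real n)) \<longlonglongrightarrow> \<beta>"
    by simp
  moreover have "real (card (red (G n))) / real (card (red (G n) \<union> blue (G n))) * (1 - 1 / real n)
      = 2 * real (card (red (G n))) / (real n)\<^sup>2" if "2 \<le> n" for n
  proof -
    have pairs: "real (card (red (G n) \<union> blue (G n))) = real n * (real n - 1) / 2"
      using G[of n] rb_cliqueD[of "G n"] that by (simp add: real_choose_two)
    have "real n \<noteq> 0" "real n - 1 \<noteq> 0" using that by auto
    then show ?thesis unfolding pairs by (simp add: divide_simps power2_eq_square)
  qed
  ultimately show ?thesis
    by (rule Lim_transform_eventually[OF _ eventually_at_top_linorderI[of 2]])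
qed

lemma rho_le_sqrt_power:
  assumes T: "simple_graph T" "connected_graph T" "2 \<le> card (uverts T)"
    and G: "has_density G \<beta>" "good (all_red T) G"
    and \<beta>: "1 - 1 / real (card (uverts T)) ^ 4 < \<beta>"
  shows "rho (all_red T) G \<le> sqrt \<beta> ^ card (uverts T)"
proof -
  let ?h = "card (uverts T)" and ?D = "\<lambda>n. 2 * real (card (red (G n)))"
  note lim = red_density_tendsto[OF G(1)]
  have "(\<lambda>n. real (inj_count (all_red T) (G n)) / real n ^ ?h) \<longlonglongrightarrow> rho (all_red T) G"
    using G(2) by (simp add: good_def rho_def all_red_def convergent_LIMSEQ_iff)
  moreover have "(\<lambda>n. sqrt (?D n / (real n)\<^sup>2) ^ ?h) \<longlonglongrightarrow> sqrt \<beta> ^ ?h"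
    by (intro tendsto_intros lim)
  moreover have "\<forall>\<^sub>F n in sequentially. real (inj_count (all_red T) (G n)) / real n ^ ?h \<le> sqrt (?D n / (real n)\<^sup>2) ^ ?h"
    using order_tendstoD(1)[OF lim \<beta>] eventually_ge_at_top[of 1]
  proof eventually_elim
    case (elim n)
    have "rb_clique (G n)" "card (verts (G n)) = n"
      using G(1) elim by (auto simp: has_density_def)
    moreover have "(1 - 1 / real ?h ^ 4) * (real n)\<^sup>2 \<le> ?D n"
      using elim by (simp add: pos_less_divide_eq)
    ultimately have "real (inj_count (all_red T) (G n)) \<le> sqrt (?D n) ^ ?h"
      using inj_count_le_sqrt_power[OF T, of "G n"] by simp
    then show ?case
      using elim by (simp add: real_sqrt_divide power_divide divide_right_mono)
  qed
  ultimately show ?thesis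
    by (intro LIMSEQ_le) (auto simp: eventually_sequentially)
qed

section \<open>The clique with isolated vertices\<close>

lemma rb_clique_K:
  assumes "a \<le> n"
  shows "rb_clique (clique_of_graph (K_graph a n))"
proof -
  have "[{..<a}]\<^bsup>2\<^esup> \<subseteq> [{..<n}]\<^bsup>2\<^esup>" using assms by (intro nsets_mono) auto
  then show ?thesis
    by (auto simp: rb_clique_def rb_graph_def clique_of_graph_def K_graph_def)
qed

lemma has_density_K:
  assumes "\<And>n. 1 \<le> n \<Longrightarrow> a n \<le> n" "(\<lambda>n. real (a n) / real n) \<longlonglongrightarrow> sqrt \<beta>" "0 \<le> \<beta>"
  shows "has_density (\<lambda>n. clique_of_graph (K_graph (a n) n)) \<beta>"
  unfolding has_density_def
proof (intro conjI allI impI)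
  let ?G = "\<lambda>n. clique_of_graph (K_graph (a n) n)"
  let ?r = "\<lambda>n. real (a n) / real n"
  show "rb_clique (?G n)" if "1 \<le> n" for n using rb_clique_K assms(1) that by blast
  show "card (verts (?G n)) = n" for n by (simp add: clique_of_graph_def K_graph_def)
  have "(\<lambda>n. ?r n * (?r n - 1 / real n) / (1 - 1 / real n)) \<longlonglongrightarrow> sqrt \<beta> * (sqrt \<beta> - 0) / (1 - 0)"
    by (intro tendsto_intros lim_1_over_n assms(2)) auto
  then have "(\<lambda>n. ?r n * (?r n - 1 / real n) / (1 - 1 / real n)) \<longlonglongrightarrow> \<beta>"
    using assms(3) by simp
  moreover have "?r n * (?r n - 1 / real n) / (1 - 1 / real n)
      = real (card (red (?G n))) / real (card (red (?G n) \<union> blue (?G n)))" if "2 \<le> n" for n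
  proof -
    have "red (?G n) \<union> blue (?G n) = [{..<n}]\<^bsup>2\<^esup>"
      using rb_cliqueD(3)[OF rb_clique_K[OF assms(1)[of n]]] that by (simp add: clique_of_graph_def K_graph_def)
    moreover have "red (?G n) = [{..<a n}]\<^bsup>2\<^esup>" by (simp add: clique_of_graph_def K_graph_def)
    moreover have "real n \<noteq> 0" "real n - 1 \<noteq> 0" using that by auto
    ultimately show ?thesis by (simp add: real_choose_two divide_simps)
  qed
  ultimately show "(\<lambda>n. real (card (red (?G n))) / real (card (red (?G n) \<union> blue (?G n)))) \<longlonglongrightarrow> \<beta>"
    by (rule Lim_transform_eventually[OF _ eventually_at_top_linorderI[of 2]])
qed

text \<open>
  Every vertex of \<open>T\<close> lies on an edge, and red edges of \<open>K(a,n)\<close> stay inside its clique. So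
  the copies of \<open>T\<close> are exactly the injections into the clique, and their number is a falling
  factorial. If \<open>a < card (uverts T)\<close>, some factor \<open>a - i\<close> is \<open>0\<close>.
\<close>

lemma inj_count_K:
  assumes T: "simple_graph T" "connected_graph T" "2 \<le> card (uverts T)" and "a \<le> n"
  shows "inj_count (all_red T) (clique_of_graph (K_graph a n)) = (\<Prod>i<card (uverts T). a - i)"
proof -
  have fin: "finite (uverts T)" using T by (simp add: simple_graph_def)
  have edge_at: "\<exists>w. {x, w} \<in> uedges T" if "x \<in> uverts T" for x
  proof -
    have "uverts T \<noteq> {x}" using T(3) by auto
    then show ?thesis
      using cut_connected_graph[OF T(1,2), unfolded cut_connected_def, rule_format, of "{x}"] that by auto
  qed
  have "(f \<in> uverts T \<rightarrow>\<^sub>E {..<n} \<and> inj_on f (uverts T) \<and> (\<forall>e\<in>uedges T. f ` e \<in> [{..<a}]\<^bsup>2\<^esup>))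
    \<longleftrightarrow> (f \<in> uverts T \<rightarrow>\<^sub>E {..<a} \<and> inj_on f (uverts T))" for f
  proof (intro iffI conjI; elim conjE)
    assume f: "f \<in> uverts T \<rightarrow>\<^sub>E {..<n}" "\<forall>e\<in>uedges T. f ` e \<in> [{..<a}]\<^bsup>2\<^esup>"
    have "f x < a" if "x \<in> uverts T" for x
    proof -
      obtain w where "{x, w} \<in> uedges T" using edge_at \<open>x \<in> uverts T\<close> by blast
      with f(2) have "f ` {x, w} \<in> [{..<a}]\<^bsup>2\<^esup>" by blast
      then show ?thesis by simp
    qed
    with f(1) show "f \<in> uverts T \<rightarrow>\<^sub>E {..<a}" by (auto simp: PiE_iff)
  next
    assume f: "f \<in> uverts T \<rightarrow>\<^sub>E {..<a}" "inj_on f (uverts T)"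
    show "f \<in> uverts T \<rightarrow>\<^sub>E {..<n}" using f(1) \<open>a \<le> n\<close> by (auto simp: PiE_iff)
    show "\<forall>e\<in>uedges T. f ` e \<in> [{..<a}]\<^bsup>2\<^esup>"
    proof
      fix e assume "e \<in> uedges T"
      then have "e \<in> [uverts T]\<^bsup>2\<^esup>" using T(1) by (auto simp: simple_graph_def)
      then obtain x y where "e = {x, y}" "x \<in> uverts T" "y \<in> uverts T" "x \<noteq> y"
        by (auto elim!: nsets2_E)
      with f show "f ` e \<in> [{..<a}]\<^bsup>2\<^esup>" by (auto simp: inj_on_eq_iff PiE_iff)
    qed
  qed auto
  then have "inj_count (all_red T) (clique_of_graph (K_graph a n))
      = card {f \<in> uverts T \<rightarrow>\<^sub>E {..<a}. inj_on f (uverts T)}"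
    by (simp add: inj_count_def all_red_def clique_of_graph_def K_graph_def)
  also have "\<dots> = (\<Prod>i<card (uverts T). a - i)"
    using card_inj_on_subset_funcset[OF fin, of "{..<a}" "uverts T"] by (simp add: lessThan_atLeast0)
  finally show ?thesis .
qed

lemma inj_count_K_tendsto:
  assumes T: "simple_graph T" "connected_graph T" "2 \<le> card (uverts T)"
    and a: "\<And>n. 1 \<le> n \<Longrightarrow> a n \<le> n" "(\<lambda>n. real (a n) / real n) \<longlonglongrightarrow> c"
  shows "(\<lambda>n. real (inj_count (all_red T) (clique_of_graph (K_graph (a n) n))) / real n ^ card (uverts T))
    \<longlonglongrightarrow> c ^ card (uverts T)"
proof -
  let ?h = "card (uverts T)"
  have "(\<lambda>n. real (a n - i) / real n) \<longlonglongrightarrow> c" for i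
  proof (rule tendsto_sandwich)
    have "(\<lambda>n. real (a n) / real n - real i * (1 / real n)) \<longlonglongrightarrow> c - real i * 0"
      by (intro tendsto_intros a(2) lim_1_over_n)
    then show "(\<lambda>n. real (a n) / real n - real i * (1 / real n)) \<longlonglongrightarrow> c" by simp
    show "\<forall>\<^sub>F n in sequentially. real (a n) / real n - real i * (1 / real n) \<le> real (a n - i) / real n"
      by (intro always_eventually allI) (simp flip: diff_divide_distrib add: divide_right_mono)
    show "\<forall>\<^sub>F n in sequentially. real (a n - i) / real n \<le> real (a n) / real n"
      by (intro always_eventually allI) (simp add: divide_right_mono)
  qed (rule a(2))
  then have "(\<lambda>n. \<Prod>i<?h. real (a n - i) / real n) \<longlonglongrightarrow> (\<Prod>i<?h. c)"
    by (intro tendsto_prod)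
  then have "(\<lambda>n. \<Prod>i<?h. real (a n - i) / real n) \<longlonglongrightarrow> c ^ ?h" by simp
  moreover have "(\<Prod>i<?h. real (a n - i) / real n)
      = real (inj_count (all_red T) (clique_of_graph (K_graph (a n) n))) / real n ^ ?h" if "1 \<le> n" for n
    using inj_count_K[OF T a(1)[OF that]] by (simp add: prod_dividef)
  ultimately show ?thesis
    by (rule Lim_transform_eventually[OF _ eventually_at_top_linorderI[of 1]])
qed

text \<open>
  The one-vertex tree is exceptional: its copies in \<open>K(a,n)\<close> need not lie in the clique. All
  sequences give the same limit \<open>1\<close>.
\<close>

lemma inj_count_single_vertex:
  assumes "uverts T = {v}" "uedges T = {}"
  shows "inj_count (all_red T) G = card (verts G)"
proof -
  have "{f \<in> {v} \<rightarrow>\<^sub>E verts G. inj_on f {v}} = {v} \<rightarrow>\<^sub>E verts G" by auto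
  then show ?thesis
    using assms by (simp add: inj_count_def all_red_def card_PiE)
qed

lemma inj_count_single_vertex_tendsto:
  assumes T: "uverts T = {v}" "uedges T = {}" and G: "has_density G \<beta>"
  shows "(\<lambda>n. real (inj_count (all_red T) (G n)) / real n ^ card (uverts T)) \<longlonglongrightarrow> 1"
proof (rule tendsto_eventually)
  show "\<forall>\<^sub>F n in sequentially. real (inj_count (all_red T) (G n)) / real n ^ card (uverts T) = 1"
    using eventually_ge_at_top[of 1]
  proof eventually_elim
    case (elim n)
    then have "card (verts (G n)) = n" using G by (simp add: has_density_def)
    then show ?case using elim inj_count_single_vertex[OF T, of "G n"] T by simp
  qed
qed

lemma I_sup_eq_rhoI:
  fixes G :: "nat \<Rightarrow> nat rb"
  assumes "has_density G \<beta>" "good H G"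
    and "\<And>G' :: nat \<Rightarrow> nat rb. has_density G' \<beta> \<Longrightarrow> good H G' \<Longrightarrow> rho H G' \<le> rho H G"
  shows "rho H G = I_sup H \<beta>"
  unfolding I_sup_def by (rule cSup_eq_maximum[symmetric]) (use assms in auto)

theorem theorem1p5:
  fixes T :: "'a ugraph"
  assumes "is_tree T"
  shows "\<exists>\<beta>\<^sub>T::real. 0 < \<beta>\<^sub>T \<and> \<beta>\<^sub>T < 1 \<and>
    (\<forall>\<beta>::real. \<beta>\<^sub>T < \<beta> \<and> \<beta> \<le> 1 \<longrightarrow>
      (\<forall>a :: nat \<Rightarrow> nat. (\<forall>n\<ge>1. a n \<le> n) \<and> (\<lambda>n. real (a n) / real n) \<longlonglongrightarrow> sqrt \<beta> \<longrightarrow>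
        has_density (\<lambda>n. clique_of_graph (K_graph (a n) n)) \<beta> \<and>
        good (all_red T) (\<lambda>n. clique_of_graph (K_graph (a n) n)) \<and>
        rho (all_red T) (\<lambda>n. clique_of_graph (K_graph (a n) n)) = I_sup (all_red T) \<beta>))"
proof -
  let ?h = "card (uverts T)"
  have T: "simple_graph T" "connected_graph T" using assms by (auto simp: is_tree_def)
  have "?h \<noteq> 0" using T by (auto simp: simple_graph_def connected_graph_def)
  \<comment> \<open>The bound for stars needs \<open>1 - h\<^bsup>-4\<^esup>\<close>; replacing \<open>h\<close> by \<open>h + 1\<close> makes the threshold positive also for \<open>h = 1\<close>.\<close>
  define \<beta>\<^sub>T where "\<beta>\<^sub>T = 1 - 1 / real (?h + 1) ^ 4"
  have "1 ^ 4 < real (?h + 1) ^ 4" using \<open>?h \<noteq> 0\<close> by (intro power_strict_mono) auto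
  then have range: "0 < \<beta>\<^sub>T" "\<beta>\<^sub>T < 1" by (simp_all add: \<beta>\<^sub>T_def)
  have optimal: "has_density G \<beta> \<and> good (all_red T) G \<and> rho (all_red T) G = I_sup (all_red T) \<beta>"
    if "\<beta>\<^sub>T < \<beta>" and a: "\<And>n. 1 \<le> n \<Longrightarrow> a n \<le> n" "(\<lambda>n. real (a n) / real n) \<longlonglongrightarrow> sqrt \<beta>"
      and G: "G = (\<lambda>n. clique_of_graph (K_graph (a n) n))" for \<beta> a G
  proof -
    have density: "has_density G \<beta>"
      unfolding G using range that by (intro has_density_K) auto
    have rhoI: "good (all_red T) G' \<and> rho (all_red T) G' = L"
      if "(\<lambda>n. real (inj_count (all_red T) (G' n)) / real n ^ ?h) \<longlonglongrightarrow> L" for G' :: "nat \<Rightarrow> nat rb" and L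
      using that by (auto simp: good_def rho_def all_red_def convergent_def limI)
    show ?thesis
    proof (cases "?h = 1")
      case True
      then obtain v where v: "uverts T = {v}" by (auto simp: card_1_singleton_iff)
      then have "uedges T = {}" using T(1) by (auto simp: simple_graph_def nsets_2_eq)
      then have "good (all_red T) G' \<and> rho (all_red T) G' = 1"
        if "has_density G' \<beta>" for G' :: "nat \<Rightarrow> nat rb"
        using rhoI inj_count_single_vertex_tendsto[OF v] that by blast
      note single = this
      have "rho (all_red T) G = I_sup (all_red T) \<beta>"
        by (rule I_sup_eq_rhoI[OF density]) (use single density in auto)
      then show ?thesis using density single by blast
    next
      case False
      then have h: "2 \<le> ?h" using \<open>?h \<noteq> 0\<close> by simp
      have "(1::real) / real (?h + 1) ^ 4 \<le> 1 / real ?h ^ 4"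
        using h by (intro divide_left_mono power_mono) auto
      then have "1 - 1 / real ?h ^ 4 < \<beta>" using \<open>\<beta>\<^sub>T < \<beta>\<close> by (simp add: \<beta>\<^sub>T_def)
      then have upper: "rho (all_red T) G' \<le> sqrt \<beta> ^ ?h"
        if "has_density G' \<beta>" "good (all_red T) G'" for G' :: "nat \<Rightarrow> nat rb"
        using rho_le_sqrt_power[OF T h that] by blast
      have K: "good (all_red T) G" "rho (all_red T) G = sqrt \<beta> ^ ?h"
        unfolding G using rhoI[OF inj_count_K_tendsto[OF T h a]] by auto
      have "rho (all_red T) G = I_sup (all_red T) \<beta>"
        by (rule I_sup_eq_rhoI[OF density]) (use K upper in auto)
      then show ?thesis using density K by blast
    qed
  qed
  show ?thesis
    using range optimal by (intro exI[of _ \<beta>\<^sub>T]) blast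
qed

end
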